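(* Let $w_1,\dots,w_N>0$ and $W=\mathrm{diag}(w_1,\dots,w_N)\otimes I_d$ (a $dN\times dN$ diagonal matrix). Let $\overline{\nabla E_A^\varepsilon}$ be a discrete gradient of $\nabla E_A^\varepsilon$ and $\Delta t>0$. The discrete gradient scheme $$\frac{\boldsymbol X^{n+1}-\boldsymbol X^n}{\Delta t}=-W^{-1}\,\overline{\nabla E_A^\varepsilon}(\boldsymbol X^{n+1},\boldsymbol X^n)$$ preserves the dissipative quantity $E_A^\varepsilon(\boldsymbol X)$; that is, any successive solutions $\boldsymbol X^n,\boldsymbol X^{n+1}\in\mathbb{R}^{dN}$ satisfy $E_A^\varepsilon(\boldsymbol X^{n+1})\le E_A^\varepsilon(\boldsymbol X^n)$.
   Context: Write $\boldsymbol X=(\boldsymbol x_1,\dots,\boldsymbol x_N)\in\mathbb{R}^{dN}$, $\boldsymbol x_p\in\mathbb{R}^d$. For $\varepsilon>0$, $$E_A^\varepsilon(\boldsymbol X)=\int_{\mathbb{R}^d}H\Big(\sum_{p=1}^N w_p\varphi_\varepsilon(\boldsymbol x-\boldsymbol x_p)\Big)d\boldsymbol x+\sum_{p=1}^N w_pV(\boldsymbol x_p)+\frac12\sum_{p,q=1}^N w_pw_q\,\mathsf W(\boldsymbol x_p-\boldsymbol x_q),$$ where $H(y)=y\log y$ or $H(y)=\frac{1}{m-1}y^m$ ($m>1$), $\varphi_\varepsilon(\boldsymbol x)=(2\pi\varepsilon)^{-d/2}\exp(-|\boldsymbol x|^2/(2\varepsilon))$, and $V,\mathsf W:\mathbb{R}^d\to\mathbb{R}$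 are $C^1$ with $\mathsf W(-\boldsymbol x)=\mathsf W(\boldsymbol x)$ (the interaction potential $\mathsf W$ is not to be confused with the weight matrix $W$). A discrete gradient of $\nabla E$ for $E:\mathbb{R}^k\to\mathbb{R}$ is a map $\overline{\nabla E}:\mathbb{R}^k\times\mathbb{R}^k\to\mathbb{R}^k$ with $\overline{\nabla E}(\boldsymbol Y,\boldsymbol X)^T(\boldsymbol Y-\boldsymbol X)=E(\boldsymbol Y)-E(\boldsymbol X)$ for all $\boldsymbol X,\boldsymbol Y$. *)

theory Defs
  imports "HOL-Analysis.Analysis"
begin

text \<open>
  A configuration of particles \<open>x\<^sub>1, \<dots>, x\<^sub>N\<close> in dimension \<open>d\<close> is a vector of dimension
  \<open>dN\<close>, represented by the type \<open>real^('n \<times> 'd)\<close> with \<open>CARD('n) = N\<close> and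
  \<open>CARD('d) = d\<close>; the entry with index \<open>(p, i)\<close> is the \<open>i\<close>-th coordinate of \<open>x\<^sub>p\<close>.
\<close>

definition particle :: "real^('n::finite \<times> 'd::finite) \<Rightarrow> 'n \<Rightarrow> real^'d" where
  "particle X p = (\<chi> i. X $ (p, i))"

definition diag_mat :: "real^'n \<Rightarrow> real^'n^'n" where
  "diag_mat w = (\<chi> i j. if i = j then w $ i else 0)"

definition kronecker ::
    "real^'b^'a \<Rightarrow> real^'d^'c \<Rightarrow> real^('b::finite \<times> 'd::finite)^('a::finite \<times> 'c::finite)" where
  "kronecker A B = (\<chi> r s. A $ fst r $ fst s * B $ snd r $ snd s)"

definition weight_matrix ::
    "real^'n \<Rightarrow> real^('n::finite \<times> 'd::finite)^('n \<times> 'd)" where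
  "weight_matrix w = kronecker (diag_mat w) (mat 1 :: real^'d^'d)"

definition C1 :: "('a::real_normed_vector \<Rightarrow> 'b::real_normed_vector) \<Rightarrow> bool" where
  "C1 f \<longleftrightarrow> (\<exists>f' :: 'a \<Rightarrow> 'a \<Rightarrow>\<^sub>L 'b.
     (\<forall>x. (f has_derivative blinfun_apply (f' x)) (at x)) \<and> continuous_on UNIV f')"

definition gaussian :: "real \<Rightarrow> real^'d::finite \<Rightarrow> real" where
  "gaussian \<epsilon> x =
     (2 * pi * \<epsilon>) powr (- real CARD('d) / 2) * exp (- (norm x)\<^sup>2 / (2 * \<epsilon>))"

text \<open>
  Only values at \<open>y > 0\<close> matter below, where \<open>ln\<close> and \<open>powr\<close> are the usual functions.
  The exponent \<open>m\<close> is real.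
\<close>

definition internal_energy_density :: "(real \<Rightarrow> real) \<Rightarrow> bool" where
  "internal_energy_density H \<longleftrightarrow>
     H = (\<lambda>y. y * ln y) \<or> (\<exists>m>1. H = (\<lambda>y. 1 / (m - 1) * y powr m))"

definition particle_energy ::
    "(real \<Rightarrow> real) \<Rightarrow> (real^'d \<Rightarrow> real) \<Rightarrow> (real^'d \<Rightarrow> real) \<Rightarrow> real^'n \<Rightarrow> real
      \<Rightarrow> real^('n::finite \<times> 'd::finite) \<Rightarrow> real" where
  "particle_energy H V K w \<epsilon> X =
     (LINT x|lborel. H (\<Sum>p\<in>UNIV. w $ p * gaussian \<epsilon> (x - particle X p)))
     + (\<Sum>p\<in>UNIV. w $ p * V (particle X p))
     + 1 / 2 * (\<Sum>p\<in>UNIV. \<Sum>q\<in>UNIV. w $ p * w $ q * K (particle X p - particle X q))"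

definition discrete_gradient ::
    "(real^'k::finite \<Rightarrow> real) \<Rightarrow> (real^'k \<Rightarrow> real^'k \<Rightarrow> real^'k) \<Rightarrow> bool" where
  "discrete_gradient E G \<longleftrightarrow> (\<forall>X Y. G Y X \<bullet> (Y - X) = E Y - E X)"

end

theory Submission
  imports Defs
begin

text \<open>
  Put \<open>u = W\<^sup>-\<^sup>1 G X' X\<close>, so that \<open>X' - X = - \<Delta>t u\<close>. The discrete gradient property turns the
  energy difference into \<open>G X' X \<bullet> (X' - X) = - \<Delta>t (W u \<bullet> u)\<close>, which is nonpositive because
  \<open>W\<close> is diagonal with positive entries.
\<close>

text \<open>The deltas in the two index components multiply to the delta on pairs, so only the
  diagonal term of each row sum survives.\<close>

lemma weight_matrix_vector_mult:
  fixes u :: "real^('n::finite \<times> 'd::finite)"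
  shows "weight_matrix w *v u = (\<chi> r. w $ fst r * u $ r)"
proof -
  have "(if fst r = fst s then w $ fst r else 0) * (if snd r = snd s then 1 else 0) * u $ s
      = (if r = s then w $ fst r * u $ r else 0)" for r s :: "'n \<times> 'd"
    by (cases r; cases s) simp
  then show ?thesis
    by (simp add: vec_eq_iff matrix_vector_mult_def weight_matrix_def kronecker_def
        diag_mat_def mat_def)
qed

text \<open>For a square matrix a trivial kernel suffices, and here the kernel can be read off
  coordinatewise.\<close>

lemma invertible_weight_matrix:
  fixes w :: "real^'n::finite"
  assumes "\<And>p. w $ p \<noteq> 0"
  shows "invertible (weight_matrix w :: real^('n \<times> 'd::finite)^('n \<times> 'd))"
  unfolding invertible_left_inverse matrix_left_invertible_ker
  by (auto simp: weight_matrix_vector_mult vec_eq_iff assms)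

text \<open>In coordinates the quadratic form is a sum of squares of the entries of \<open>u\<close>
  with weights \<open>w $ fst r\<close>.\<close>

lemma weight_matrix_inner_nonneg:
  assumes "\<And>p. w $ p \<ge> 0"
  shows "(weight_matrix w *v u) \<bullet> u \<ge> 0"
  by (auto simp: weight_matrix_vector_mult inner_vec_def mult.assoc assms intro!: sum_nonneg)

theorem lemma3p4:
  fixes H :: "real \<Rightarrow> real"
    and V K :: "real^'d::finite \<Rightarrow> real"
    and w :: "real^'n::finite"
    and \<epsilon> \<Delta>t :: real
    and G :: "real^('n \<times> 'd) \<Rightarrow> real^('n \<times> 'd) \<Rightarrow> real^('n \<times> 'd)"
    and X X' :: "real^('n \<times> 'd)"
  assumes "internal_energy_density H"
    and "C1 V"
    and "C1 K"
    and "\<And>x. K (- x) = K x"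
    and "\<epsilon> > 0"
    and "\<And>p. w $ p > 0"
    and "\<Delta>t > 0"
    and "discrete_gradient (particle_energy H V K w \<epsilon>) G"
    and "(1 / \<Delta>t) *\<^sub>R (X' - X) = - (matrix_inv (weight_matrix w) *v G X' X)"
  shows "particle_energy H V K w \<epsilon> X' \<le> particle_energy H V K w \<epsilon> X"
proof -
  define W :: "real^('n \<times> 'd)^('n \<times> 'd)" where "W = weight_matrix w"
  define u where "u = matrix_inv W *v G X' X"
  have "invertible W"
    unfolding W_def by (rule invertible_weight_matrix) (simp add: assms(6) less_imp_neq[symmetric])
  \<comment> \<open>\<open>matrix_inv\<close> is a Hilbert choice; invertibility of \<open>W\<close>
    supplies the witness for \<open>someI_ex\<close>, which gives
    \<open>W ** matrix_inv W = mat 1\<close>.\<close>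
  then have "G X' X = W *v u"
    unfolding invertible_def u_def matrix_inv_def
    by (metis (mono_tags, lifting) matrix_vector_mul_assoc matrix_vector_mul_lid someI_ex)
  moreover have "X' - X = - (\<Delta>t *\<^sub>R u)"
  proof -
    have "X' - X = \<Delta>t *\<^sub>R ((1 / \<Delta>t) *\<^sub>R (X' - X))"
      using \<open>\<Delta>t > 0\<close> by simp
    then show ?thesis
      unfolding assms(9) by (simp add: u_def W_def)
  qed
  moreover have "(W *v u) \<bullet> u \<ge> 0"
    unfolding W_def by (rule weight_matrix_inner_nonneg) (simp add: assms(6) less_imp_le)
  ultimately have "G X' X \<bullet> (X' - X) \<le> 0"
    using \<open>\<Delta>t > 0\<close> by simp
  then show ?thesis
    using assms(8) by (simp add: discrete_gradient_def)
qed

end
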